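(* Let $1\le r\le n$, $t_0\in\mathbb{R}$, and let $\psi:\Sigma^n\to\mathcal{H}^{n+1}$ be a complete spacelike hypersurface over the slice $M_{t_0}$ of the Steady State space $\mathcal{H}^{n+1}$, with sectional curvature $K_{\Sigma}\geq0$ and time-orientation opposite to that of $\partial_t$. If $H_r>0$ and $C_1\leq H_{r-1}\leq C_2$ on $\Sigma$ for some positive constants $C_1$ and $C_2$, then the height function $h$ of $\Sigma$ does not attain a local minimum on $\Sigma$.
   Context: The Steady State space is $\mathcal{H}^{n+1}=-\mathbb{R}\times_{e^t}\mathbb{R}^n$, i.e. $\mathbb{R}\times\mathbb{R}^n$ with the Lorentz metric $\langle\,,\rangle=-dt^2+e^{2t}\langle\,,\rangle_{\mathbb{R}^n}$, and Levi-Civita connection $\overline\nabla$; $\partial_t$ is the coordinate vector field of the factor $\mathbb{R}$. A spacelike hypersurface (immersion) $\psi:\Sigma^n\to\mathcal{H}^{n+1}$ is an isometric immersion from a connected, orientable $n$-dimensional Riemannian manifold $\Sigma$; it is complete if $\Sigma$ is complete. $\Sigma$ is oriented by the choice of a timelike unit normal vector field $N$, with shape operator $Av=-\overline\nabla_vN$. $\Sigma$ has the same time-orientation as $\partial_t$ if $\langle N,\partial_t\rangle\leq-1$; otherwise (i.e. $\langle N,\partial_t\rangle\geq1$) it has time-orientation opposite to that of $\partial_t$. Let $\lambda_1,\dots,\lambda_n$ be the eigenvalues of $A$; the $r$-th mean curvature is $H_r=\binom nr^{-1}\sigma_r(-\lambda_1,\dots,-\lambda_n)$, where $\sigma_r$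 is the $r$-th elementary symmetric polynomial, and $H_0=1$. The height function of $\Sigma$ is $h=\pi_{\mathbb{R}}\circ\psi:\Sigma\to\mathbb{R}$, where $\pi_{\mathbb{R}}$ is the projection of $\mathcal{H}^{n+1}$ onto the factor $\mathbb{R}$. $\psi$ is a spacelike hypersurface over the slice $M_{t_0}=\{t_0\}\times\mathbb{R}^n$ if $h\geq t_0$ on $\Sigma$. *)

theory Defs
  imports "HOL-Analysis.Analysis" "HOL-Computational_Algebra.Polynomial"
begin

section \<open>Smooth manifolds\<close>

text \<open>All uses are on open sets, so plain Frechet derivatives suffice.\<close>

primrec Ck_on :: "nat \<Rightarrow> ('a::real_normed_vector \<Rightarrow> 'b::real_normed_vector) \<Rightarrow> 'a set \<Rightarrow> bool" where
  "Ck_on 0 f S \<longleftrightarrow> continuous_on S f"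
| "Ck_on (Suc k) f S \<longleftrightarrow>
     (\<forall>x\<in>S. f differentiable (at x)) \<and>
     (\<forall>v. Ck_on k (\<lambda>x. frechet_derivative f (at x) v) S)"

definition smooth_on :: "('a::real_normed_vector \<Rightarrow> 'b::real_normed_vector) \<Rightarrow> 'a set \<Rightarrow> bool" where
  "smooth_on f S \<longleftrightarrow> (\<forall>k. Ck_on k f S)"

text \<open>
  The underlying space of a manifold is a whole Hausdorff, second countable type \<open>'m\<close>; its dimension
  is \<open>CARD('n)\<close>. A chart consists of its domain and its coordinate map, which is only meaningful on
  the domain.
\<close>

type_synonym ('m, 'n) chart = "'m set \<times> ('m \<Rightarrow> (real, 'n) vec)"

definition dom_of :: "('m, 'n) chart \<Rightarrow> 'm set" where
  "dom_of c = fst c"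

definition coord :: "('m, 'n) chart \<Rightarrow> 'm \<Rightarrow> (real, 'n) vec" where
  "coord c = snd c"

definition img :: "('m, 'n) chart \<Rightarrow> (real, 'n) vec set" where
  "img c = coord c ` dom_of c"

definition param :: "('m, 'n) chart \<Rightarrow> (real, 'n) vec \<Rightarrow> 'm" where
  "param c = inv_into (dom_of c) (coord c)"

definition is_chart :: "('m::topological_space, 'n::finite) chart \<Rightarrow> bool" where
  "is_chart c \<longleftrightarrow> open (dom_of c) \<and> open (img c) \<and>
     homeomorphism (dom_of c) (img c) (coord c) (param c)"

definition transition ::
    "('m, 'n) chart \<Rightarrow> ('m, 'n) chart \<Rightarrow> (real, 'n) vec \<Rightarrow> (real, 'n) vec" where
  "transition c d = coord d \<circ> param c"

definition smooth_atlas :: "('m::topological_space, 'n::finite) chart set \<Rightarrow> bool" where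
  "smooth_atlas \<A> \<longleftrightarrow>
     (\<forall>c\<in>\<A>. is_chart c) \<and> (\<Union>c\<in>\<A>. dom_of c) = UNIV \<and>
     (\<forall>c\<in>\<A>. \<forall>d\<in>\<A>. smooth_on (transition c d) (coord c ` (dom_of c \<inter> dom_of d)))"

text \<open>Orientability: the smooth structure given by \<open>\<A>\<close> has an oriented atlas \<open>\<B>\<close>.\<close>

definition orientable :: "('m::topological_space, 'n::finite) chart set \<Rightarrow> bool" where
  "orientable \<A> \<longleftrightarrow>
     (\<exists>\<B>. smooth_atlas \<B> \<and> smooth_atlas (\<A> \<union> \<B>) \<and>
        (\<forall>c\<in>\<B>. \<forall>d\<in>\<B>. \<forall>x\<in>coord c ` (dom_of c \<inter> dom_of d).
            det (matrix (frechet_derivative (transition c d) (at x))) > 0))"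

definition smooth_map ::
    "('m::topological_space, 'n::finite) chart set \<Rightarrow> ('m \<Rightarrow> 'b::real_normed_vector) \<Rightarrow> bool" where
  "smooth_map \<A> f \<longleftrightarrow> (\<forall>c\<in>\<A>. smooth_on (f \<circ> param c) (img c))"

text \<open>
  Tangent vectors at \<open>p\<close> are represented by their components \<open>v\<close> in a chart \<open>c\<close> around \<open>p\<close>.
\<close>

definition differential ::
    "('m, 'n::finite) chart \<Rightarrow> ('m \<Rightarrow> 'b::real_normed_vector) \<Rightarrow> 'm \<Rightarrow> (real, 'n) vec \<Rightarrow> 'b" where
  "differential c f p v = frechet_derivative (f \<circ> param c) (at (coord c p)) v"


section \<open>Levi-Civita connection and curvature in coordinates\<close>

text \<open>
  \<open>G x\<close> is a scalar product on the tangent space \<open>'a\<close> at \<open>x\<close>, of any signature. The Levi-Civita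
  connection is \<open>\<nabla>\<^sub>u V = DV(u) + \<Gamma>(u, V)\<close>, where \<open>\<Gamma>\<close> is the unique bilinear map that is symmetric
  (no torsion) and compatible with the metric.
\<close>

definition levi_civita ::
    "('a::real_normed_vector \<Rightarrow> 'a \<Rightarrow> 'a \<Rightarrow> real) \<Rightarrow> 'a \<Rightarrow> 'a \<Rightarrow> 'a \<Rightarrow> 'a" where
  "levi_civita G x = (THE \<Gamma>. bilinear \<Gamma> \<and> (\<forall>v w. \<Gamma> v w = \<Gamma> w v) \<and>
     (\<forall>u v w. frechet_derivative (\<lambda>y. G y v w) (at x) u = G x (\<Gamma> u v) w + G x v (\<Gamma> u w)))"

text \<open>Covariant derivative, in direction \<open>v\<close>, of a vector field \<open>V\<close> along a map \<open>F\<close>.\<close>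

definition cov_deriv_along ::
    "('a::real_normed_vector \<Rightarrow> 'a \<Rightarrow> 'a \<Rightarrow> real) \<Rightarrow> ('b::real_normed_vector \<Rightarrow> 'a) \<Rightarrow> ('b \<Rightarrow> 'a) \<Rightarrow>
     'b \<Rightarrow> 'b \<Rightarrow> 'a" where
  "cov_deriv_along G F V x v =
     frechet_derivative V (at x) v +
     levi_civita G (F x) (frechet_derivative F (at x) v) (V x)"

text \<open>
  \<open>R(u,v)w = \<nabla>\<^sub>u \<nabla>\<^sub>v w - \<nabla>\<^sub>v \<nabla>\<^sub>u w\<close> for vector fields \<open>u, v, w\<close> with constant components.
\<close>

definition curvature ::
    "('a::real_normed_vector \<Rightarrow> 'a \<Rightarrow> 'a \<Rightarrow> real) \<Rightarrow> 'a \<Rightarrow> 'a \<Rightarrow> 'a \<Rightarrow> 'a \<Rightarrow> 'a" where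
  "curvature G x u v w =
     frechet_derivative (\<lambda>y. levi_civita G y v w) (at x) u -
     frechet_derivative (\<lambda>y. levi_civita G y u w) (at x) v +
     levi_civita G x u (levi_civita G x v w) - levi_civita G x v (levi_civita G x u w)"

definition sectional_curvature ::
    "('a::real_normed_vector \<Rightarrow> 'a \<Rightarrow> 'a \<Rightarrow> real) \<Rightarrow> 'a \<Rightarrow> 'a \<Rightarrow> 'a \<Rightarrow> real" where
  "sectional_curvature G x u v =
     G x (curvature G x u v v) u / (G x u u * G x v v - (G x u v)\<^sup>2)"


section \<open>Riemannian manifolds\<close>

text \<open>\<open>g c x\<close> is the metric tensor in the chart \<open>c\<close>, at the point with coordinates \<open>x\<close>.\<close>

type_synonym ('m, 'n) metric_tensor =
  "('m, 'n) chart \<Rightarrow> (real, 'n) vec \<Rightarrow> (real, 'n) vec \<Rightarrow> (real, 'n) vec \<Rightarrow> real"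

definition riemannian_metric ::
    "('m::topological_space, 'n::finite) chart set \<Rightarrow> ('m, 'n) metric_tensor \<Rightarrow> bool" where
  "riemannian_metric \<A> g \<longleftrightarrow>
     (\<forall>c\<in>\<A>. \<forall>x\<in>img c. bilinear (g c x) \<and> (\<forall>v w. g c x v w = g c x w v) \<and>
        (\<forall>v. v \<noteq> 0 \<longrightarrow> g c x v v > 0)) \<and>
     (\<forall>c\<in>\<A>. \<forall>v w. smooth_on (\<lambda>x. g c x v w) (img c)) \<and>
     (\<forall>c\<in>\<A>. \<forall>d\<in>\<A>. \<forall>x\<in>coord c ` (dom_of c \<inter> dom_of d). \<forall>v w.
        g c x v w = g d (transition c d x)
          (frechet_derivative (transition c d) (at x) v)
          (frechet_derivative (transition c d) (at x) w))"

definition riemannian_manifold ::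
    "('m::{t2_space,second_countable_topology}, 'n::finite) chart set \<Rightarrow>
     ('m, 'n) metric_tensor \<Rightarrow> bool" where
  "riemannian_manifold \<A> g \<longleftrightarrow> smooth_atlas \<A> \<and> riemannian_metric \<A> g"

text \<open>A geodesic defined on all of \<open>\<real>\<close>, given by \<open>x'' + \<Gamma>(x', x') = 0\<close> in every chart.\<close>

definition geodesic_line ::
    "('m::topological_space, 'n::finite) chart set \<Rightarrow> ('m, 'n) metric_tensor \<Rightarrow>
     (real \<Rightarrow> 'm) \<Rightarrow> bool" where
  "geodesic_line \<A> g \<gamma> \<longleftrightarrow> continuous_on UNIV \<gamma> \<and>
     (\<forall>c\<in>\<A>. \<forall>s. \<gamma> s \<in> dom_of c \<longrightarrow>
        (let x = coord c \<circ> \<gamma>; x' = (\<lambda>t. vector_derivative x (at t))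
         in x differentiable (at s) \<and>
            (x' has_vector_derivative - levi_civita (g c) (x s) (x' s) (x' s)) (at s)))"

text \<open>
  Geodesic completeness. For connected manifolds it is equivalent to metric completeness by the
  Hopf-Rinow theorem.
\<close>

definition complete_riemannian ::
    "('m::topological_space, 'n::finite) chart set \<Rightarrow> ('m, 'n) metric_tensor \<Rightarrow> bool" where
  "complete_riemannian \<A> g \<longleftrightarrow>
     (\<forall>c\<in>\<A>. \<forall>p\<in>dom_of c. \<forall>v. \<exists>\<gamma>. geodesic_line \<A> g \<gamma> \<and> \<gamma> 0 = p \<and>
        ((coord c \<circ> \<gamma>) has_vector_derivative v) (at 0))"

definition nonneg_sectional_curvature ::
    "('m::topological_space, 'n::finite) chart set \<Rightarrow> ('m, 'n) metric_tensor \<Rightarrow> bool" where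
  "nonneg_sectional_curvature \<A> g \<longleftrightarrow>
     (\<forall>c\<in>\<A>. \<forall>x\<in>img c. \<forall>u v. u \<noteq> v \<and> independent {u, v} \<longrightarrow>
        sectional_curvature (g c) x u v \<ge> 0)"


section \<open>Spacelike hypersurfaces of the Steady State space\<close>

text \<open>The Steady State space has the global chart \<open>\<real> \<times> \<real>\<^sup>n\<close>.\<close>

type_synonym 'n steady_state = "real \<times> (real, 'n) vec"

definition ss_metric ::
    "'n::finite steady_state \<Rightarrow> 'n steady_state \<Rightarrow> 'n steady_state \<Rightarrow> real" where
  "ss_metric q v w = - (fst v * fst w) + exp (2 * fst q) * (snd v \<bullet> snd w)"

definition d_t :: "'n::finite steady_state" where
  "d_t = (1, 0)"

definition isometric_immersion ::
    "('m::topological_space, 'n::finite) chart set \<Rightarrow> ('m, 'n) metric_tensor \<Rightarrow>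
     ('m \<Rightarrow> 'n steady_state) \<Rightarrow> bool" where
  "isometric_immersion \<A> g \<psi> \<longleftrightarrow> smooth_map \<A> \<psi> \<and>
     (\<forall>c\<in>\<A>. \<forall>p\<in>dom_of c. inj (differential c \<psi> p) \<and>
        (\<forall>v w. ss_metric (\<psi> p) (differential c \<psi> p v) (differential c \<psi> p w) =
               g c (coord c p) v w))"

definition unit_normal_field ::
    "('m::topological_space, 'n::finite) chart set \<Rightarrow> ('m \<Rightarrow> 'n steady_state) \<Rightarrow>
     ('m \<Rightarrow> 'n steady_state) \<Rightarrow> bool" where
  "unit_normal_field \<A> \<psi> N \<longleftrightarrow> smooth_map \<A> N \<and>
     (\<forall>p. ss_metric (\<psi> p) (N p) (N p) = -1) \<and>
     (\<forall>c\<in>\<A>. \<forall>p\<in>dom_of c. \<forall>v. ss_metric (\<psi> p) (N p) (differential c \<psi> p v) = 0)"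

definition spacelike_hypersurface ::
    "('m::{t2_space,second_countable_topology}, 'n::finite) chart set \<Rightarrow>
     ('m, 'n) metric_tensor \<Rightarrow> ('m \<Rightarrow> 'n steady_state) \<Rightarrow> ('m \<Rightarrow> 'n steady_state) \<Rightarrow> bool" where
  "spacelike_hypersurface \<A> g \<psi> N \<longleftrightarrow>
     riemannian_manifold \<A> g \<and> connected (UNIV :: 'm set) \<and> orientable \<A> \<and>
     isometric_immersion \<A> g \<psi> \<and> unit_normal_field \<A> \<psi> N"

definition opposite_time_orientation ::
    "('m \<Rightarrow> 'n::finite steady_state) \<Rightarrow> ('m \<Rightarrow> 'n steady_state) \<Rightarrow> bool" where
  "opposite_time_orientation \<psi> N \<longleftrightarrow> (\<forall>p. ss_metric (\<psi> p) (N p) d_t \<ge> 1)"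

definition height :: "('m \<Rightarrow> 'n steady_state) \<Rightarrow> 'm \<Rightarrow> real" where
  "height \<psi> = fst \<circ> \<psi>"

definition over_slice :: "real \<Rightarrow> ('m \<Rightarrow> 'n steady_state) \<Rightarrow> bool" where
  "over_slice t0 \<psi> \<longleftrightarrow> (\<forall>p. height \<psi> p \<ge> t0)"

text \<open>\<open>Av\<close> is the tangent vector with \<open>d\<psi>(Av)\<close> equal to minus the ambient derivative of \<open>N\<close> along \<open>v\<close>.\<close>

definition shape_operator ::
    "('m, 'n::finite) chart \<Rightarrow> ('m \<Rightarrow> 'n steady_state) \<Rightarrow> ('m \<Rightarrow> 'n steady_state) \<Rightarrow>
     'm \<Rightarrow> (real, 'n) vec \<Rightarrow> (real, 'n) vec" where
  "shape_operator c \<psi> N p v =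
     (THE u. differential c \<psi> p u =
        - cov_deriv_along ss_metric (\<psi> \<circ> param c) (N \<circ> param c) (coord c p) v)"

definition char_polynomial :: "((real, 'n::finite) vec \<Rightarrow> (real, 'n) vec) \<Rightarrow> real poly" where
  "char_polynomial L = det (\<chi> i j. (if i = j then [:0, 1:] else 0) - [:matrix L $ i $ j:])"

text \<open>Real eigenvalues, repeated according to algebraic multiplicity.\<close>

definition eigenvalues :: "((real, 'n::finite) vec \<Rightarrow> (real, 'n) vec) \<Rightarrow> real list" where
  "eigenvalues L = sorted_list_of_multiset (proots (char_polynomial L))"

definition elem_sym :: "nat \<Rightarrow> real list \<Rightarrow> real" where
  "elem_sym r xs = (\<Sum>S | S \<subseteq> {..<length xs} \<and> card S = r. \<Prod>i\<in>S. xs ! i)"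

text \<open>\<open>H r p\<close> does not depend on the chart around \<open>p\<close> in which the shape operator is expressed.\<close>

definition chart_at :: "('m, 'n) chart set \<Rightarrow> 'm \<Rightarrow> ('m, 'n) chart" where
  "chart_at \<A> p = (SOME c. c \<in> \<A> \<and> p \<in> dom_of c)"

definition mean_curvature ::
    "('m, 'n::finite) chart set \<Rightarrow> ('m \<Rightarrow> 'n steady_state) \<Rightarrow> ('m \<Rightarrow> 'n steady_state) \<Rightarrow>
     nat \<Rightarrow> 'm \<Rightarrow> real" where
  "mean_curvature \<A> \<psi> N r p =
     elem_sym r (map uminus (eigenvalues (shape_operator (chart_at \<A> p) \<psi> N p))) /
     real (CARD('n) choose r)"

definition has_local_min_at :: "('m::topological_space \<Rightarrow> real) \<Rightarrow> 'm \<Rightarrow> bool" where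
  "has_local_min_at f p \<longleftrightarrow> (\<exists>U. open U \<and> p \<in> U \<and> (\<forall>q\<in>U. f p \<le> f q))"

end

theory Submission
  imports Defs
begin

text \<open>
  The obstruction sits at a single point. Suppose that the height function \<open>h\<close> has a local minimum at
  \<open>p\<close>. There \<open>dh = 0\<close>, so the tangent space of the hypersurface is horizontal, and the time-orientation
  forces \<open>N = -d_t\<close>. Every horizontal vector \<open>w\<close> satisfies \<open>\<nabla>\<^sub>w d_t = w\<close>, and differentiating
  \<open>\<langle>N, d\<psi> v\<rangle> = 0\<close> along \<open>v\<close> gives, at \<open>p\<close>, \<open>Hess h(v, v) = \<langle>Av, v\<rangle> - \<langle>v, v\<rangle>\<close>. The Hessian is
  nonnegative at a minimum, so every eigenvalue of \<open>A\<close> at \<open>p\<close> is at least 1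
  (\<open>eigenvalues_shape_operator_at_height_min\<close>).

  Hence all the numbers \<open>-\<lambda>\<^sub>i\<close> are negative, and their \<open>k\<close>-th elementary symmetric polynomial cannot
  be positive when \<open>k\<close> is odd (\<open>elem_sym_sign\<close>). One of \<open>r\<close> and \<open>r - 1\<close> is odd, which contradicts
  the positivity of both \<open>H\<^sub>r\<close> and \<open>H\<^bsub>r-1\<^esub>\<close> at \<open>p\<close>.

  In a chart, all of this concerns two maps \<open>F\<close> and \<open>n\<close> from an open subset of \<open>\<real>\<^sup>n\<close> to
  \<open>\<real> \<times> \<real>\<^sup>n\<close>, the local expressions of \<open>\<psi>\<close> and \<open>N\<close>; \<open>normal_derivative_at_height_min\<close> carries out
  the computation for them.
\<close>

section \<open>The connection of the Steady State space\<close>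

lemma has_derivative_ss_metric_along:
  fixes F X Y :: "'b::real_normed_vector \<Rightarrow> 'n::finite steady_state"
  assumes F: "(F has_derivative F') (at x)"
    and X: "(X has_derivative X') (at x)"
    and Y: "(Y has_derivative Y') (at x)"
  shows "((\<lambda>y. ss_metric (F y) (X y) (Y y)) has_derivative
     (\<lambda>v. 2 * fst (F' v) * exp (2 * fst (F x)) * (snd (X x) \<bullet> snd (Y x)) +
          ss_metric (F x) (X' v) (Y x) + ss_metric (F x) (X x) (Y' v))) (at x)"
  unfolding ss_metric_def
  apply (rule derivative_eq_intros F X Y refl)+
  by (auto simp: algebra_simps)

lemma ss_metric_nondegenerate:
  assumes "\<And>w. ss_metric q z w = 0"
  shows "z = 0"
proof -
  have "fst z = 0" using assms[of "(1, 0)"] by (simp add: ss_metric_def)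
  moreover have "snd z = 0" using assms[of "(0, snd z)"] by (simp add: ss_metric_def)
  ultimately show ?thesis by (simp add: prod_eq_iff)
qed

text \<open>
  This is the connection of the warped product \<open>-\<real> \<times>\<^bsub>f\<^esub> \<real>\<^sup>n\<close> with \<open>f(t) = exp t\<close>, for which
  \<open>f'/f = 1\<close> and \<open>f f' = exp (2 t)\<close>.
\<close>

lemma levi_civita_ss_metric:
  fixes q :: "'n::finite steady_state"
  shows "levi_civita ss_metric q u v =
    (exp (2 * fst q) * (snd u \<bullet> snd v), fst u *\<^sub>R snd v + fst v *\<^sub>R snd u)"
proof -
  define \<Gamma> :: "'n steady_state \<Rightarrow> 'n steady_state \<Rightarrow> 'n steady_state" where
    "\<Gamma> u v = (exp (2 * fst q) * (snd u \<bullet> snd v), fst u *\<^sub>R snd v + fst v *\<^sub>R snd u)" for u v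
  have deriv: "frechet_derivative (\<lambda>y. ss_metric y v w) (at q) u =
      2 * fst u * exp (2 * fst q) * (snd v \<bullet> snd w)" for u v w :: "'n steady_state"
  proof -
    have "((\<lambda>y. ss_metric y v w) has_derivative
        (\<lambda>u. 2 * fst u * exp (2 * fst q) * (snd v \<bullet> snd w))) (at q)"
      using has_derivative_ss_metric_along[OF has_derivative_ident has_derivative_const
          has_derivative_const, of v w q]
      by (simp add: ss_metric_def)
    from frechet_derivative_at[OF this] show ?thesis by metis
  qed
  have "levi_civita ss_metric q = \<Gamma>"
    unfolding levi_civita_def deriv
  proof (rule the_equality)
    show "bilinear \<Gamma> \<and> (\<forall>v w. \<Gamma> v w = \<Gamma> w v) \<and>
      (\<forall>u v w. 2 * fst u * exp (2 * fst q) * (snd v \<bullet> snd w) =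
        ss_metric q (\<Gamma> u v) w + ss_metric q v (\<Gamma> u w))"
    proof (intro conjI allI)
      show "bilinear \<Gamma>"
        unfolding bilinear_def \<Gamma>_def
        by (auto intro!: linearI simp: algebra_simps inner_add_left inner_add_right)
    qed (auto simp: \<Gamma>_def ss_metric_def algebra_simps inner_add_left inner_add_right inner_commute)
  next
    fix \<Delta> :: "'n steady_state \<Rightarrow> 'n steady_state \<Rightarrow> 'n steady_state"
    assume \<Delta>: "bilinear \<Delta> \<and> (\<forall>v w. \<Delta> v w = \<Delta> w v) \<and>
      (\<forall>u v w. 2 * fst u * exp (2 * fst q) * (snd v \<bullet> snd w) =
        ss_metric q (\<Delta> u v) w + ss_metric q v (\<Delta> u w))"
    \<comment> \<open>The difference of two torsion-free metric connections, lowered by the metric, is symmetric in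
      the first two arguments and skew in the last two. Only zero has both symmetries.\<close>
    define S where "S u v w = ss_metric q (\<Delta> u v - \<Gamma> u v) w" for u v w
    have "2 * fst u * exp (2 * fst q) * (snd v \<bullet> snd w) =
        ss_metric q (\<Gamma> u v) w + ss_metric q v (\<Gamma> u w)" for u v w
      by (auto simp: \<Gamma>_def ss_metric_def algebra_simps inner_add_left inner_add_right inner_commute)
    with \<Delta> have "ss_metric q (\<Delta> u v) w + ss_metric q v (\<Delta> u w) =
        ss_metric q (\<Gamma> u v) w + ss_metric q v (\<Gamma> u w)" for u v w
      by metis
    then have anti: "S u v w = - S u w v" for u v w
      unfolding S_def ss_metric_def
      by (simp add: algebra_simps inner_diff_left inner_diff_right inner_commute)
    have sym: "S u v w = S v u w" for u v w
      using \<Delta> unfolding S_def \<Gamma>_def by (metis add.commute inner_commute)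
    have "S u v w = 0" for u v w
      using anti[of u v w] sym[of u w v] anti[of w u v] sym[of w v u] anti[of v w u] sym[of v u w]
      by linarith
    then have "\<Delta> u v - \<Gamma> u v = 0" for u v
      unfolding S_def by (rule ss_metric_nondegenerate)
    then show "\<Delta> = \<Gamma>" by (simp add: fun_eq_iff)
  qed
  then show ?thesis by (simp add: \<Gamma>_def)
qed

section \<open>Calculus and algebra\<close>

lemma second_derivative_nonneg_at_local_min:
  fixes f f' :: "real \<Rightarrow> real"
  assumes f: "eventually (\<lambda>s. (f has_real_derivative f' s) (at s)) (nhds a)"
    and f': "(f' has_real_derivative D) (at a)" and crit: "f' a = 0"
    and min: "eventually (\<lambda>s. f a \<le> f s) (nhds a)"
  shows "D \<ge> 0"
proof (rule ccontr)
  assume "\<not> D \<ge> 0"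
  then obtain d where d: "d > 0" "\<And>h. 0 < h \<Longrightarrow> h < d \<Longrightarrow> f' (a + h) < 0"
    using DERIV_neg_dec_right[OF f'] crit by auto
  obtain e where e: "e > 0"
    "\<And>s. dist s a < e \<Longrightarrow> (f has_real_derivative f' s) (at s) \<and> f a \<le> f s"
    using eventually_conj[OF f min] unfolding eventually_nhds_metric by blast
  define h where "h = min d e / 2"
  have h: "0 < h" "h < d" "h < e" using d(1) e(1) by (auto simp: h_def)
  have "\<exists>z. a < z \<and> z < a + h \<and> f (a + h) - f a = (a + h - a) * f' z"
    using h e(2) by (intro MVT2) (auto simp: dist_real_def)
  then obtain z where z: "a < z" "z < a + h" "f (a + h) - f a = h * f' z" by auto
  have "f' z < 0" using d(2)[of "z - a"] z h by auto
  then have "f (a + h) < f a" using z h by (smt (verit) mult_pos_neg)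
  moreover have "f a \<le> f (a + h)" using e(2)[of "a + h"] h by (simp add: dist_real_def)
  ultimately show False by simp
qed

text \<open>
  Each of the products of \<open>r\<close> nonpositive entries has the sign of \<open>(-1)\<^sup>r\<close>, or is zero.
\<close>

lemma elem_sym_sign:
  assumes "\<And>x. x \<in> set xs \<Longrightarrow> x \<le> 0"
  shows "(-1) ^ r * elem_sym r xs \<ge> 0"
proof -
  have "(-1) ^ r * (\<Prod>i\<in>S. xs ! i) \<ge> 0" if "S \<subseteq> {..<length xs}" "card S = r" for S
  proof -
    have "(-1) ^ r * (\<Prod>i\<in>S. xs ! i) = (\<Prod>i\<in>S. - (xs ! i))"
      using that by (simp add: prod_uminus)
    also have "\<dots> \<ge> 0"
      using that assms by (intro prod_nonneg) (auto simp: subset_iff)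
    finally show ?thesis .
  qed
  then show ?thesis
    unfolding elem_sym_def sum_distrib_left by (intro sum_nonneg) auto
qed

lemma poly_char_polynomial:
  "poly (char_polynomial L) x = det (mat x - matrix L)"
  unfolding char_polynomial_def det_def
  by (auto simp: poly_sum poly_prod mat_def intro!: sum.cong prod.cong)

lemma eigenvector_exists:
  assumes "linear L" and "x \<in> set (eigenvalues L)"
  obtains v where "v \<noteq> 0" "L v = x *\<^sub>R v"
proof -
  have "det (mat x - matrix L) = 0"
    using assms(2) unfolding eigenvalues_def
    by (cases "char_polynomial L = 0") (auto simp flip: poly_char_polynomial)
  then have "\<not> (\<forall>v. (mat x - matrix L) *v v = 0 \<longrightarrow> v = 0)"
    by (metis invertible_det_nz invertible_left_inverse matrix_left_invertible_ker)
  then obtain v where v: "v \<noteq> 0" "(mat x - matrix L) *v v = 0" by blast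
  have "mat x *v v = x *\<^sub>R v"
    by (simp add: vec_eq_iff matrix_vector_mult_def mat_def if_distrib if_distribR sum.delta cong: if_cong)
  then have "L v = x *\<^sub>R v"
    using v(2) assms(1) by (simp add: matrix_vector_mult_diff_rdistrib matrix_works)
  with v(1) that show thesis by blast
qed

section \<open>The shape operator at a minimum of the height\<close>

text \<open>
  \<open>B\<close> is the differential of the hypersurface at the minimum, identified with a linear automorphism
  of \<open>\<real>\<^sup>n\<close> because the tangent space is horizontal there. The last conclusion is the second derivative
  test: since \<open>n = -d_t\<close> at the minimum, differentiating \<open>\<langle>n, dF v\<rangle> = 0\<close> along \<open>v\<close> shows that
  \<open>-exp (2 t) (n' v \<bullet> B v)\<close> is the second derivative of the height in direction \<open>v\<close>.
\<close>

lemma normal_derivative_at_height_min: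
  fixes F n :: "real^'n \<Rightarrow> 'n::finite steady_state"
  assumes S: "open S" "x0 \<in> S"
    and F: "\<And>x. x \<in> S \<Longrightarrow> F differentiable (at x)"
    and dF: "\<And>v. (\<lambda>x. frechet_derivative F (at x) v) differentiable (at x0)"
    and n: "n differentiable (at x0)"
    and unit: "\<And>x. x \<in> S \<Longrightarrow> ss_metric (F x) (n x) (n x) = -1"
    and normal: "\<And>x v. x \<in> S \<Longrightarrow> ss_metric (F x) (n x) (frechet_derivative F (at x) v) = 0"
    and inj: "inj (frechet_derivative F (at x0))"
    and opp: "ss_metric (F x0) (n x0) d_t \<ge> 1"
    and min: "eventually (\<lambda>x. fst (F x0) \<le> fst (F x)) (nhds x0)"
  defines "B \<equiv> \<lambda>v. snd (frechet_derivative F (at x0) v)"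
    and "n' \<equiv> frechet_derivative n (at x0)"
  shows "linear B" "inj B" "\<And>v. frechet_derivative F (at x0) v = (0, B v)"
    "n x0 = (-1, 0)" "\<And>v. fst (n' v) = 0" "\<And>v. snd (n' v) \<bullet> B v \<le> 0"
proof -
  define F' where "F' x = frechet_derivative F (at x)" for x
  have F': "(F has_derivative F' x) (at x)" if "x \<in> S" for x
    using F[OF that] unfolding F'_def frechet_derivative_works .
  have n': "(n has_derivative n') (at x0)"
    using n unfolding n'_def frechet_derivative_works .
  have Fl: "linear (F' x0)" using F'[OF S(2)] by (rule has_derivative_linear)
  show B: "linear B"
    using Fl unfolding B_def F'_def[symmetric]
    by (intro linearI) (auto simp: linear_add linear_scale)
  have crit: "fst (F' x0 v) = 0" for v
  proof -
    have "((\<lambda>x. fst (F x)) has_derivative (\<lambda>v. fst (F' x0 v))) (at x0)"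
      by (intro has_derivative_fst F' S)
    moreover obtain e where "e > 0" "\<forall>x\<in>ball x0 e. fst (F x0) \<le> fst (F x)"
      using min unfolding eventually_nhds_metric by (auto simp: dist_commute)
    ultimately have "(\<lambda>v. fst (F' x0 v)) = (\<lambda>v. 0)"
      by (intro differential_zero_maxmin[of x0 "ball x0 e" "\<lambda>x. fst (F x)"]) auto
    then show ?thesis by metis
  qed
  show F'B: "frechet_derivative F (at x0) v = (0, B v)" for v
    using crit[of v] by (simp add: B_def F'_def prod_eq_iff)
  show Binj: "inj B" using inj F'B unfolding inj_def by auto
  then have "surj B" using B by (simp add: linear_injective_imp_surjective)
  \<comment> \<open>The tangent space is all of \<open>0 \<times> \<real>\<^sup>n\<close>, so it contains the horizontal part of the normal, which
    must therefore vanish.\<close>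
  then obtain w where w: "B w = snd (n x0)" by (metis surjD)
  have n2: "snd (n x0) = 0"
    using normal[OF S(2), of w] by (simp add: F'B ss_metric_def w)
  have n1: "fst (n x0) = -1"
  proof -
    have "(fst (n x0))\<^sup>2 = 1" "fst (n x0) \<le> -1"
      using unit[OF S(2)] opp n2 by (auto simp: ss_metric_def d_t_def power2_eq_square)
    then show ?thesis by (auto simp: power2_eq_1_iff)
  qed
  show n0: "n x0 = (-1, 0)" using n1 n2 by (simp add: prod_eq_iff)
  show n'1: "fst (n' v) = 0" for v
  proof -
    have "((\<lambda>x. ss_metric (F x) (n x) (n x)) has_derivative (\<lambda>v. 0)) (at x0)"
      by (rule has_derivative_transform_within_open[OF has_derivative_const S, of "-1"])
         (simp add: unit)
    from fun_cong[OF has_derivative_unique[OF this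
        has_derivative_ss_metric_along[OF F'[OF S(2)] n' n']], of v]
    show ?thesis by (simp add: n0 ss_metric_def)
  qed
  show "snd (n' v) \<bullet> B v \<le> 0" for v
  proof -
    define D where "D = frechet_derivative (\<lambda>x. F' x v) (at x0)"
    have D: "((\<lambda>x. F' x v) has_derivative D) (at x0)"
      using dF[of v] unfolding D_def F'_def frechet_derivative_works .
    have "((\<lambda>x. ss_metric (F x) (n x) (F' x v)) has_derivative (\<lambda>v. 0)) (at x0)"
      by (rule has_derivative_transform_within_open[OF has_derivative_const S, of 0])
         (simp add: normal F'_def)
    from fun_cong[OF has_derivative_unique[OF this
        has_derivative_ss_metric_along[OF F'[OF S(2)] n' D]], of v]
    have hess: "fst (D v) = - exp (2 * fst (F x0)) * (snd (n' v) \<bullet> B v)"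
      by (simp add: n0 ss_metric_def crit n'1 B_def F'_def)
    define line where "line s = x0 + s *\<^sub>R v" for s :: real
    have line': "(line has_derivative (\<lambda>h. h *\<^sub>R v)) (at s)" for s
      unfolding line_def by (auto intro!: derivative_eq_intros)
    have "filterlim line (nhds (line 0)) (nhds 0)"
      using has_derivative_continuous[OF line'[of 0]]
      by (simp only: continuous_at tendsto_at_iff_tendsto_nhds)
    then have tend: "filterlim line (nhds x0) (nhds 0)" by (simp add: line_def)
    have "fst (D v) \<ge> 0"
    proof (rule second_derivative_nonneg_at_local_min)
      have "eventually (\<lambda>s. line s \<in> S) (nhds 0)"
        using topological_tendstoD[OF tend S] .
      then show "eventually (\<lambda>s. ((\<lambda>s. fst (F (line s))) has_real_derivative
          fst (F' (line s) v)) (at s)) (nhds 0)"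
      proof eventually_elim
        case (elim s)
        have "((\<lambda>s. F (line s)) has_derivative (\<lambda>h. F' (line s) (h *\<^sub>R v))) (at s)"
          using has_derivative_compose[OF line' F'[OF elim]] by simp
        from has_derivative_fst[OF this] show ?case
          using has_derivative_linear[OF F'[OF elim]]
          by (simp add: has_field_derivative_def linear_scale mult_commute_abs)
      qed
      have "((\<lambda>s. F' (line s) v) has_derivative (\<lambda>h. D (h *\<^sub>R v))) (at 0)"
        using has_derivative_compose[OF line'[of 0], of "\<lambda>x. F' x v" D] D by (simp add: line_def)
      from has_derivative_fst[OF this]
      show "((\<lambda>s. fst (F' (line s) v)) has_real_derivative fst (D v)) (at 0)"
        using has_derivative_linear[OF D]
        by (simp add: has_field_derivative_def linear_scale mult_commute_abs)
      show "fst (F' (line 0) v) = 0" by (simp add: line_def crit)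
      show "eventually (\<lambda>s. fst (F (line 0)) \<le> fst (F (line s))) (nhds 0)"
        using eventually_compose_filterlim[OF min tend] by (simp add: line_def)
    qed
    with hess show ?thesis by (simp add: mult_le_0_iff)
  qed
qed

text \<open>
  Write \<open>B v\<close> and \<open>n' v\<close> for the horizontal parts of the derivatives of \<open>\<psi>\<close> and \<open>N\<close> along \<open>v\<close>; their
  time components vanish at \<open>p\<close>. With \<open>N = -d_t\<close> at \<open>p\<close>, the connection contributes \<open>-B v\<close> to the derivative of \<open>N\<close> along \<open>v\<close>, so
  \<open>B (A v) = B v - n' v\<close>. For an eigenvector this reads \<open>n' v = (1 - l) B v\<close>, and pairing it with
  \<open>B v\<close> turns the second derivative test into \<open>1 - l \<le> 0\<close>.
\<close>

lemma eigenvalues_shape_operator_at_height_min: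
  fixes \<psi> N :: "'m::{t2_space,second_countable_topology} \<Rightarrow> 'n::finite steady_state"
  assumes hyp: "spacelike_hypersurface \<A> g \<psi> N"
    and opp: "opposite_time_orientation \<psi> N"
    and c: "c \<in> \<A>" "p \<in> dom_of c"
    and min: "has_local_min_at (height \<psi>) p"
    and ev: "l \<in> set (eigenvalues (shape_operator c \<psi> N p))"
  shows "l \<ge> 1"
proof -
  define F where "F = \<psi> \<circ> param c"
  define n where "n = N \<circ> param c"
  define S where "S = img c"
  define x0 where "x0 = coord c p"
  have chart: "is_chart c" and imm: "isometric_immersion \<A> g \<psi>"
    and nor: "unit_normal_field \<A> \<psi> N"
    using hyp c by (auto simp: spacelike_hypersurface_def riemannian_manifold_def smooth_atlas_def)
  have S: "open S" "x0 \<in> S" and hom: "homeomorphism (dom_of c) S (coord c) (param c)"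
    using chart c by (auto simp: is_chart_def S_def x0_def img_def)
  have par: "param c x \<in> dom_of c" "coord c (param c x) = x" if "x \<in> S" for x
    using hom that by (auto simp: homeomorphism_def)
  have par0: "param c x0 = p" using hom c by (simp add: x0_def homeomorphism_def)
  have "smooth_on F S" "smooth_on n S"
    using imm nor c
    by (simp_all add: isometric_immersion_def unit_normal_field_def smooth_map_def
        F_def n_def S_def)
  then have "Ck_on (Suc (Suc 0)) F S" "Ck_on (Suc 0) n S"
    unfolding smooth_on_def by blast+
  then have F: "F differentiable (at x)" "(\<lambda>x. frechet_derivative F (at x) v) differentiable (at x)"
    and n: "n differentiable (at x)" if "x \<in> S" for x v
    using that by auto
  have diff: "differential c \<psi> (param c x) = frechet_derivative F (at x)" if "x \<in> S" for x
    using par[OF that] by (auto simp: differential_def F_def)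
  have min': "eventually (\<lambda>x. fst (F x0) \<le> fst (F x)) (nhds x0)"
  proof -
    obtain U where U: "open U" "p \<in> U" "\<forall>q\<in>U. height \<psi> p \<le> height \<psi> q"
      using min by (auto simp: has_local_min_at_def)
    have "continuous_on S (param c)" using hom by (simp add: homeomorphism_def)
    then have "isCont (param c) x0" using S by (simp add: continuous_on_eq_continuous_at)
    then have "filterlim (param c) (nhds (param c x0)) (nhds x0)"
      by (simp only: continuous_at tendsto_at_iff_tendsto_nhds)
    then have "eventually (\<lambda>x. param c x \<in> U) (nhds x0)"
      using U(1,2) unfolding par0 by (rule topological_tendstoD)
    then show ?thesis
      by eventually_elim (use U par0 in \<open>simp add: height_def F_def\<close>)
  qed
  define B where "B v = snd (frechet_derivative F (at x0) v)" for v
  define n' where "n' = frechet_derivative n (at x0)"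
  have unit: "ss_metric (F x) (n x) (n x) = -1" if "x \<in> S" for x
    using nor by (simp add: unit_normal_field_def F_def n_def)
  have normal: "ss_metric (F x) (n x) (frechet_derivative F (at x) v) = 0" if "x \<in> S" for x v
    using nor c par[OF that] diff[OF that]
    by (force simp: unit_normal_field_def F_def n_def)
  have inj: "inj (frechet_derivative F (at x0))"
    using imm c unfolding diff[OF S(2), unfolded par0, symmetric]
    by (simp add: isometric_immersion_def)
  have opp0: "ss_metric (F x0) (n x0) d_t \<ge> 1"
    using opp by (simp add: opposite_time_orientation_def F_def n_def)
  note at_min = normal_derivative_at_height_min[OF S F(1) F(2)[OF S(2)] n[OF S(2)] unit normal
      inj opp0 min', folded n'_def, folded B_def]
  have B: "linear B" "inj B" "\<And>v. frechet_derivative F (at x0) v = (0, B v)"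
    "n x0 = (-1, 0)" "\<And>v. fst (n' v) = 0" "\<And>v. snd (n' v) \<bullet> B v \<le> 0"
    by (rule at_min; assumption)+
  have n'l: "linear n'"
    using n[OF S(2)] unfolding n'_def by (rule linear_frechet_derivative)
  obtain B' where B': "linear B'" "B' \<circ> B = id"
    using linear_injective_left_inverse[OF B(1,2)] by blast
  have bij: "B (B' w) = w" "B' (B w) = w" for w
    using B' linear_inverse_left[OF B'(1) B(1)] by (auto simp: fun_eq_iff)
  have shape: "shape_operator c \<psi> N p v = v - B' (snd (n' v))" for v
  proof -
    have "- cov_deriv_along ss_metric F n x0 v = (0, B v - snd (n' v))"
      using B(5)[of v]
      by (simp add: cov_deriv_along_def levi_civita_ss_metric B(3,4) n'_def[symmetric] prod_eq_iff)
    moreover have "differential c \<psi> p u = (0, B u)" for u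
      using diff[OF S(2)] par0 B(3) by simp
    ultimately have "shape_operator c \<psi> N p v = (THE u. B u = B v - snd (n' v))"
      by (simp add: shape_operator_def F_def n_def x0_def)
    also have "\<dots> = v - B' (snd (n' v))"
    proof (rule the_equality)
      show "B (v - B' (snd (n' v))) = B v - snd (n' v)"
        by (simp add: linear_diff[OF B(1)] bij)
      then show "u = v - B' (snd (n' v))" if "B u = B v - snd (n' v)" for u
        using that B(2) by (metis injD)
    qed
    finally show ?thesis .
  qed
  have "linear (shape_operator c \<psi> N p)"
    by (intro linearI) (simp_all add: shape linear_add[OF n'l] linear_add[OF B'(1)]
        linear_scale[OF n'l] linear_scale[OF B'(1)] algebra_simps)
  then obtain v where v: "v \<noteq> 0" "shape_operator c \<psi> N p v = l *\<^sub>R v"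
    using eigenvector_exists ev by blast
  have "B' (snd (n' v)) = (1 - l) *\<^sub>R v" using v(2) by (simp add: shape algebra_simps)
  then have "snd (n' v) = (1 - l) *\<^sub>R B v"
    by (metis bij(1) linear_scale[OF B(1)])
  then have "(1 - l) * (B v \<bullet> B v) \<le> 0" using B(6)[of v] by simp
  moreover have "B v \<noteq> 0" using v(1) bij(2)[of v] linear_0[OF B'(1)] by metis
  ultimately show ?thesis
    by (metis diff_ge_0_iff_ge inner_gt_zero_iff linorder_not_less minus_diff_eq mult_pos_pos
        neg_0_le_iff_le neg_0_less_iff_less)
qed

section \<open>No local minimum of the height\<close>

theorem theorem4p7:
  fixes \<A> :: "('m::{t2_space,second_countable_topology}, 'n::finite) chart set"
    and g :: "('m, 'n) metric_tensor"
    and \<psi> N :: "'m \<Rightarrow> 'n steady_state"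
    and r :: nat and t0 :: real
  assumes "1 \<le> r" and "r \<le> CARD('n)"
    and "spacelike_hypersurface \<A> g \<psi> N"
    and "complete_riemannian \<A> g"
    and "over_slice t0 \<psi>"
    and "nonneg_sectional_curvature \<A> g"
    and "opposite_time_orientation \<psi> N"
    and "\<forall>p. mean_curvature \<A> \<psi> N r p > 0"
    and "\<exists>C1>0. \<exists>C2>0. \<forall>p. C1 \<le> mean_curvature \<A> \<psi> N (r - 1) p \<and>
                            mean_curvature \<A> \<psi> N (r - 1) p \<le> C2"
  shows "\<not> (\<exists>p. has_local_min_at (height \<psi>) p)"
proof
  assume "\<exists>p. has_local_min_at (height \<psi>) p"
  then obtain p where p: "has_local_min_at (height \<psi>) p" by blast
  define c where "c = chart_at \<A> p"
  have "\<exists>c. c \<in> \<A> \<and> p \<in> dom_of c"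
    using assms(3)
    by (fastforce simp: spacelike_hypersurface_def riemannian_manifold_def smooth_atlas_def)
  then have c: "c \<in> \<A>" "p \<in> dom_of c"
    unfolding c_def chart_at_def by (metis (mono_tags, lifting) someI_ex)+
  define xs where "xs = map uminus (eigenvalues (shape_operator c \<psi> N p))"
  have "x \<le> 0" if "x \<in> set xs" for x
    using that eigenvalues_shape_operator_at_height_min[OF assms(3,7) c p]
    by (fastforce simp: xs_def)
  then have nonpos: "elem_sym k xs \<le> 0" if "odd k" for k
    using elem_sym_sign[of xs k] that by simp
  have pos: "mean_curvature \<A> \<psi> N r p > 0" "mean_curvature \<A> \<psi> N (r - 1) p > 0"
    using assms(8,9) by (auto intro: less_le_trans)
  then have "elem_sym r xs > 0" "elem_sym (r - 1) xs > 0"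
    unfolding mean_curvature_def xs_def c_def by (auto simp: zero_less_divide_iff)
  moreover have "odd r \<or> odd (r - 1)" using assms(1) by presburger
  ultimately show False using nonpos by (meson not_less)
qed

end
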